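(* In the setting described in the context, let $\mathring P\triangleq\{\mathbf{z}_{\mathrm r}\in\mathbb{R}^{n_{\mathrm r}}:\mathring{\mathbf{H}}\mathbf{z}_{\mathrm r}\le\mathring{\mathbf{k}},\ \mathring{\mathbf{A}}\mathbf{z}_{\mathrm r}=\mathring{\mathbf{b}}\}$ with $$\mathring{\mathbf{H}}\triangleq\mathbf{H}_{\mathrm r}-\mathbf{H}_{\mathrm e}\mathbf{A}_{\mathrm{ee}}^{-1}\mathbf{A}_{\mathrm{er}},\quad \mathring{\mathbf{k}}\triangleq\mathbf{k}_p-\mathbf{H}_{\mathrm e}\mathbf{A}_{\mathrm{ee}}^{-1}\mathbf{b}_{\mathrm e},\quad \mathring{\mathbf{A}}\triangleq\mathbf{A}_{\mathrm{rr}}-\mathbf{A}_{\mathrm{re}}\mathbf{A}_{\mathrm{ee}}^{-1}\mathbf{A}_{\mathrm{er}},\quad \mathring{\mathbf{b}}\triangleq\mathbf{b}_{\mathrm r}-\mathbf{A}_{\mathrm{re}}\mathbf{A}_{\mathrm{ee}}^{-1}\mathbf{b}_{\mathrm e},$$ and let $\tilde Z_{\mathrm r}$ denote the last $n_{\mathrm r}-(n_x+n_w+n_v)$ components of the interval $Z_{\mathrm r}$. Define $$\hat X_k'\triangleq\mathbf{G}_f\big((\hat X_{k-1}\times W\times V\times\tilde Z_{\mathrm r})\cap\mathring P\big)\oplus\mathbf{c}_f,\qquad \mathbf{G}_f\triangleq\mathbf{E}_{\mathrm r}-\mathbf{E}_{\mathrm e}\mathbf{A}_{\mathrm{ee}}^{-1}\mathbf{A}_{\mathrm{er}},\qquad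 \mathbf{c}_f\triangleq\mathbf{E}_{\mathrm e}\mathbf{A}_{\mathrm{ee}}^{-1}\mathbf{b}_{\mathrm e}.$$ Then: 1. $\hat X_k'$ is a valid enclosure of $\underline{X}_k$, i.e. $\underline{X}_k\subseteq\hat X_k'$. 2. Let $\hat X_k\triangleq\mathbf{E}_f\big((\hat X_{k-1}\times W\times V\times\tilde Z)\cap P_\ell\cap P_y\big)$. If $\mathbf{A}_{\mathrm{ee}}^{-1}(\mathbf{b}_{\mathrm e}-\mathbf{A}_{\mathrm{er}}\mathbf{z}_{\mathrm r})\in Z_{\mathrm e}$ for all $\mathbf{z}_{\mathrm r}\in Z_{\mathrm r}$, then $\hat X_k'=\hat X_k$ (equality as sets).
   Context: General notation. A constrained zonotope in $\mathbb{R}^n$ is a set $\{\mathbf{c}+\mathbf{G}\boldsymbol{\xi}:\|\boldsymbol{\xi}\|_\infty\le1,\ \mathbf{A}\boldsymbol{\xi}=\mathbf{b}\}$. For a bounded set $S$, $\square S$ is its interval hull. $\mathbf{R}Y=\{\mathbf{R}\mathbf{y}:\mathbf{y}\in Y\}$; $\oplus$ is the Minkowski sum (with a vector: translation). $\mathbf{h}(Y)$ is the exact image of $Y$ under $\mathbf{h}$. For compact real intervals $X,Y$ and $\odot\in\{+,-,\times,/\}$, $X\odot Y=\{x\odot y:x\in X,y\in Y\}$ (division only if $0\notin Y$). Factorable function. Fix a library $\mathcal{L}$ of real univariate functions (including $x\mapsto x+q$ and $x\mapsto qx$ for constants $q\in\mathbb{R}$), for which images of compact intervals inside the domain are compact intervals.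 A function $\boldsymbol{\varphi}:D\subseteq\mathbb{R}^{n_s}\to\mathbb{R}^{n_\varphi}$ is factorable if there are factors $\zeta_j:D\to\mathbb{R}$, $j=1,\ldots,n_z$, with: $\zeta_j(\mathbf{s})=s_j$ for $j\le n_s$; for each $j>n_s$ either $\zeta_j=\zeta_a\odot\zeta_b$ with $a,b<j$, $\odot\in\{+,-,\times,/\}$, or $\zeta_j=\beta_j(\zeta_a)$ with $a<j$, $\beta_j\in\mathcal{L}$; and $\boldsymbol{\varphi}=\mathbf{E}_\varphi\boldsymbol{\zeta}$ where $\mathbf{E}_\varphi$ is zero except for a single $1$ in each row. The corresponding elementary operations are $\alpha_j(\mathbf{z})=z_j$ for $j\le n_s$, and for $j>n_s$, $\alpha_j(\mathbf{z})=z_a\odot z_b$ or $\alpha_j(\mathbf{z})=\beta_j(z_a)$ respectively. System setting. $\mathbf{f}:\mathbb{R}^{n_x}\times\mathbb{R}^{n_w}\times\mathbb{R}^{n_u}\to\mathbb{R}^{n_x}$ and $\mathbf{g}:\mathbb{R}^{n_x}\times\mathbb{R}^{n_v}\to\mathbb{R}^{n_y}$ are factorable; $\mathbf{u}_{k-1}\in\mathbb{R}^{n_u}$, $\mathbf{y}_k\in\mathbb{R}^{n_y}$ are given; $\hat X_{k-1}\subset\mathbb{R}^{n_x}$, $W\subset\mathbb{R}^{n_w}$, $V\subset\mathbb{R}^{n_v}$ are nonempty constrained zonotopes; $n_s=n_x+n_w+n_v$; $\mathbf{s}=(\mathbf{x}_{k-1},\mathbf{w}_{k-1},\mathbf{v}_k)$;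 $S=\hat X_{k-1}\times W\times V$. The composite $\boldsymbol{\ell}(\mathbf{s})=\mathbf{g}(\mathbf{f}(\mathbf{x}_{k-1},\mathbf{w}_{k-1},\mathbf{u}_{k-1}),\mathbf{v}_k)$ is factorable with factors $\boldsymbol{\zeta}=(\zeta_1,\ldots,\zeta_{n_z})$ (on a domain containing $\square S$) and operations $\alpha_1,\ldots,\alpha_{n_z}$, obtained by first factoring $\mathbf{f}(\cdot,\cdot,\mathbf{u}_{k-1})$ and then $\mathbf{g}$; $\mathbf{E}_\ell$, $\mathbf{E}_f$ are matrices with a single $1$ per row and zeros elsewhere such that $\boldsymbol{\ell}(\mathbf{s})=\mathbf{E}_\ell\boldsymbol{\zeta}(\mathbf{s})$ and $\mathbf{f}(\mathbf{x}_{k-1},\mathbf{w}_{k-1},\mathbf{u}_{k-1})=\mathbf{E}_f\boldsymbol{\zeta}(\mathbf{s})$. The set to be enclosed is $$\underline{X}_k=\{\mathbf{x}_k:\mathbf{x}_k=\mathbf{f}(\mathbf{x}_{k-1},\mathbf{w}_{k-1},\mathbf{u}_{k-1}),\ \mathbf{y}_k=\mathbf{g}(\mathbf{x}_k,\mathbf{v}_k)\text{ for some }(\mathbf{x}_{k-1},\mathbf{w}_{k-1},\mathbf{v}_k)\in S\}.$$ Enclosures (standing assumption). $Z=Z_1\times\cdots\times Z_{n_z}$ is the interval computed by interval arithmetic from $\square S$: $Z_j=(\square S)_j$ for $j\le n_s$, and for $j>n_s$ recursively $Z_j=Z_a\odot Z_b$ or $Z_j=\beta_j(Z_a)$ according to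 $\alpha_j$ (all these evaluations are assumed well defined). Hence $\boldsymbol{\zeta}(\square S)\subseteq Z$. $\tilde Z$ denotes the last $n_z-n_s$ components of $Z$. $P_\ell=\bigcap_{j=n_s+1}^{n_z}Q_j$, where each $Q_j\subset\mathbb{R}^{n_z}$ is a convex polyhedron given by finitely many linear inequalities and equalities with $Q_j\supseteq\{\mathbf{z}\in Z:z_j=\alpha_j(\mathbf{z})\}$, and, specifically, if $\alpha_j$ is $z_a+z_b$, $z_a-z_b$, $z_a+q_j$ or $q_jz_a$ ($q_j\in\mathbb{R}$ constant), then $Q_j$ is given by the single equality $z_j-z_a-z_b=0$, $z_j-z_a+z_b=0$, $z_j-z_a=q_j$, or $z_j-q_jz_a=0$, respectively (and no inequalities). $P_y=\{\mathbf{z}\in\mathbb{R}^{n_z}:\mathbf{E}_\ell\mathbf{z}=\mathbf{y}_k\}$. The representation $P_\ell\cap P_y=\{\mathbf{z}:\mathbf{H}_p\mathbf{z}\le\mathbf{k}_p,\ \mathbf{A}_p\mathbf{z}=\mathbf{b}_p\}$ is obtained by stacking all constraints of the $Q_j$ and of $P_y$. Elimination notation. $\mathcal{I}_{\mathrm e}$ is the set of indices $j\in\{n_s+1,\ldots,n_z\}$ for which $\alpha_j$ is one of the four operations $z_a+z_b$, $z_a-z_b$, $z_a+q_j$, $q_jz_a$; $\mathcal{I}_{\mathrm r}=\{1,\ldots,n_z\}\setminus\mathcal{I}_{\mathrm e}$; $n_{\mathrm e}=|\mathcal{I}_{\mathrm e}|$, $n_{\mathrm r}=|\mathcal{I}_{\mathrm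 r}|$. $\mathbf{U}$ is the permutation matrix with $\mathbf{U}\mathbf{z}=(\mathbf{z}_{\mathrm e},\mathbf{z}_{\mathrm r})$, where $\mathbf{z}_{\mathrm e}$ (resp. $\mathbf{z}_{\mathrm r}$) collects the $z_j$ with $j\in\mathcal{I}_{\mathrm e}$ (resp. $j\in\mathcal{I}_{\mathrm r}$) in ascending order of $j$; likewise $(Z_{\mathrm e},Z_{\mathrm r})=\mathbf{U}Z$ is the reordering of the components of $Z$. The rows of $(\mathbf{A}_p,\mathbf{b}_p)$ are permuted so that the first $n_{\mathrm e}$ rows are the equalities of $Q_j$, $j\in\mathcal{I}_{\mathrm e}$, in ascending order of $j$, followed by the remaining rows in original order; together with the column permutation, $\mathbf{A}_p\mathbf{z}=\mathbf{b}_p$ becomes $$\begin{bmatrix}\mathbf{A}_{\mathrm{ee}}&\mathbf{A}_{\mathrm{er}}\\ \mathbf{A}_{\mathrm{re}}&\mathbf{A}_{\mathrm{rr}}\end{bmatrix}\begin{bmatrix}\mathbf{z}_{\mathrm e}\\ \mathbf{z}_{\mathrm r}\end{bmatrix}=\begin{bmatrix}\mathbf{b}_{\mathrm e}\\ \mathbf{b}_{\mathrm r}\end{bmatrix},$$ with $\mathbf{A}_{\mathrm{ee}}\in\mathbb{R}^{n_{\mathrm e}\times n_{\mathrm e}}$, which is invertible (it is lower triangular with unit diagonal). Also $[\mathbf{H}_{\mathrm e}\ \mathbf{H}_{\mathrm r}]=\mathbf{H}_p\mathbf{U}^{-1}$ and $[\mathbf{E}_{\mathrm e}\ \mathbf{E}_{\mathrm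 r}]=\mathbf{E}_f\mathbf{U}^{-1}$, partitioned conformably with $(\mathbf{z}_{\mathrm e},\mathbf{z}_{\mathrm r})$. *)

theory Defs
  imports Complex_Main "Jordan_Normal_Form.Gauss_Jordan_Elimination"
begin

(* Vectors and matrices are those of Jordan_Normal_Form; all component indices start at 0. *)

section \<open>Sets of vectors\<close>

text \<open>In the following definition, \<open>\<bar>\<xi> $ i\<bar> \<le> 1\<close> for all \<open>i\<close> spells out that the infinity
  norm of \<open>\<xi>\<close> is at most 1.  There may be no generators or no constraints.\<close>

definition constrained_zonotope :: "nat \<Rightarrow> real vec set \<Rightarrow> bool" where
  "constrained_zonotope n X \<longleftrightarrow>
     (\<exists>ng nc c G A b. c \<in> carrier_vec n \<and> G \<in> carrier_mat n ng \<and>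
        A \<in> carrier_mat nc ng \<and> b \<in> carrier_vec nc \<and>
        X = {c + G *\<^sub>v \<xi> | \<xi>. \<xi> \<in> carrier_vec ng \<and> (\<forall>i<ng. \<bar>\<xi> $ i\<bar> \<le> 1) \<and> A *\<^sub>v \<xi> = b})"

text \<open>The smallest interval containing \<open>S\<close>; the order on vectors is componentwise.\<close>

definition interval_hull :: "real vec set \<Rightarrow> real vec set" where
  "interval_hull S = \<Inter> {{l..u} | l u. S \<subseteq> {l..u}}"

text \<open>An interval of dimension \<open>n\<close> is also given by the list of its \<open>n\<close> components.\<close>

definition box :: "real set list \<Rightarrow> real vec set" where
  "box Zs = {z \<in> carrier_vec (length Zs). \<forall>i<length Zs. z $ i \<in> Zs ! i}"

definition vec_times :: "real vec set \<Rightarrow> real vec set \<Rightarrow> real vec set" (infixr \<open>\<times>\<^sub>v\<close> 75) where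
  "X \<times>\<^sub>v Y = {x @\<^sub>v y | x y. x \<in> X \<and> y \<in> Y}"

definition polyhedron :: "nat \<Rightarrow> real mat \<Rightarrow> real vec \<Rightarrow> real mat \<Rightarrow> real vec \<Rightarrow> real vec set" where
  "polyhedron n H k A b = {z \<in> carrier_vec n. H *\<^sub>v z \<le> k \<and> A *\<^sub>v z = b}"

section \<open>Factorable functions\<close>

text \<open>Library functions may have a restricted domain, hence the partial functions.\<close>

definition add_const :: "real \<Rightarrow> real \<rightharpoonup> real" where
  "add_const q = (\<lambda>x. Some (x + q))"

definition mult_const :: "real \<Rightarrow> real \<rightharpoonup> real" where
  "mult_const q = (\<lambda>x. Some (q * x))"

definition univariate_library :: "(real \<rightharpoonup> real) set \<Rightarrow> bool" where
  "univariate_library L \<longleftrightarrow>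
     (\<forall>q. add_const q \<in> L \<and> mult_const q \<in> L) \<and>
     (\<forall>\<beta>\<in>L. \<forall>a b. a \<le> b \<and> {a..b} \<subseteq> dom \<beta> \<longrightarrow>
        (\<exists>c d. c \<le> d \<and> (\<lambda>x. the (\<beta> x)) ` {a..b} = {c..d}))"

datatype arith = Plus | Minus | Times | Divide

fun arith_fun :: "arith \<Rightarrow> real \<Rightarrow> real \<Rightarrow> real" where
  "arith_fun Plus x y = x + y"
| "arith_fun Minus x y = x - y"
| "arith_fun Times x y = x * y"
| "arith_fun Divide x y = x / y"

text \<open>The elementary operations other than the projections to the first \<open>ns\<close> components;
  the natural numbers are the indices of the operands.\<close>

datatype elem_op = Bin arith nat nat | Uni "real \<rightharpoonup> real" nat

fun op_args :: "elem_op \<Rightarrow> nat set" where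
  "op_args (Bin bop a b) = {a, b}"
| "op_args (Uni \<beta> a) = {a}"

fun op_val :: "elem_op \<Rightarrow> real vec \<Rightarrow> real" where
  "op_val (Bin bop a b) z = arith_fun bop (z $ a) (z $ b)"
| "op_val (Uni \<beta> a) z = the (\<beta> (z $ a))"

fun op_defined :: "elem_op \<Rightarrow> real vec \<Rightarrow> bool" where
  "op_defined (Bin bop a b) z \<longleftrightarrow> (bop = Divide \<longrightarrow> z $ b \<noteq> 0)"
| "op_defined (Uni \<beta> a) z \<longleftrightarrow> z $ a \<in> dom \<beta>"

fun op_in_library :: "(real \<rightharpoonup> real) set \<Rightarrow> elem_op \<Rightarrow> bool" where
  "op_in_library L (Bin bop a b) \<longleftrightarrow> True"
| "op_in_library L (Uni \<beta> a) \<longleftrightarrow> \<beta> \<in> L"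

text \<open>Here \<open>\<zeta> s\<close> is the vector of all \<open>nz\<close> factors at \<open>s\<close>, and \<open>\<alpha> j\<close> is used for
  \<open>ns \<le> j < nz\<close> only.\<close>

definition factors ::
  "(real \<rightharpoonup> real) set \<Rightarrow> real vec set \<Rightarrow> nat \<Rightarrow> nat \<Rightarrow> (nat \<Rightarrow> elem_op) \<Rightarrow> (real vec \<Rightarrow> real vec) \<Rightarrow> bool"
  where
  "factors L D ns nz \<alpha> \<zeta> \<longleftrightarrow>
     D \<subseteq> carrier_vec ns \<and> ns \<le> nz \<and>
     (\<forall>j\<in>{ns..<nz}. op_in_library L (\<alpha> j) \<and> op_args (\<alpha> j) \<subseteq> {..<j}) \<and>
     (\<forall>s\<in>D. \<zeta> s \<in> carrier_vec nz \<and>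
        (\<forall>j<ns. \<zeta> s $ j = s $ j) \<and>
        (\<forall>j\<in>{ns..<nz}. op_defined (\<alpha> j) (\<zeta> s) \<and> \<zeta> s $ j = op_val (\<alpha> j) (\<zeta> s)))"

definition selection_mat :: "nat \<Rightarrow> nat \<Rightarrow> real mat \<Rightarrow> bool" where
  "selection_mat m n E \<longleftrightarrow> E \<in> carrier_mat m n \<and>
     (\<forall>i<m. \<exists>k<n. \<forall>l<n. E $$ (i, l) = (if l = k then 1 else 0))"

definition factorable ::
  "(real \<rightharpoonup> real) set \<Rightarrow> real vec set \<Rightarrow> nat \<Rightarrow> nat \<Rightarrow> (real vec \<Rightarrow> real vec) \<Rightarrow> bool" where
  "factorable L D ns n\<phi> \<phi> \<longleftrightarrow>
     (\<exists>nz \<alpha> \<zeta> E. factors L D ns nz \<alpha> \<zeta> \<and> selection_mat n\<phi> nz E \<and> (\<forall>s\<in>D. \<phi> s = E *\<^sub>v \<zeta> s))"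

definition selected :: "real mat \<Rightarrow> nat set" where
  "selected E = {k. k < dim_col E \<and> (\<exists>i<dim_row E. E $$ (i, k) = 1)}"

text \<open>The factorization of \<open>(x, w, v) \<mapsto> g (f (x, w, u), v)\<close> consists of one of \<open>f (\<cdot>, \<cdot>, u)\<close>,
  with operations \<open>ns \<le> j < nf\<close>, followed by one of \<open>g\<close>, with operations \<open>nf \<le> j < nz\<close>.
  The former has the variables \<open>x\<close> and \<open>w\<close>; the latter has as its variables the factors which
  \<open>E\<^sub>f\<close> selects as the components of \<open>f\<close>, and \<open>v\<close>.\<close>

definition composite_order ::
  "nat \<Rightarrow> nat \<Rightarrow> nat \<Rightarrow> nat \<Rightarrow> (nat \<Rightarrow> elem_op) \<Rightarrow> real mat \<Rightarrow> real mat \<Rightarrow> bool" where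
  "composite_order nx nw nv nz \<alpha> Ef El \<longleftrightarrow>
     (let ns = nx + nw + nv in
      \<exists>nf. ns \<le> nf \<and> nf \<le> nz \<and>
        (let F = {..<nx + nw} \<union> {ns..<nf};
             G = selected Ef \<union> {nx + nw..<ns} \<union> {nf..<nz}
         in (\<forall>j\<in>{ns..<nf}. op_args (\<alpha> j) \<subseteq> F) \<and> selected Ef \<subseteq> F \<and>
            (\<forall>j\<in>{nf..<nz}. op_args (\<alpha> j) \<subseteq> G) \<and> selected El \<subseteq> G))"

section \<open>Interval arithmetic and polyhedral relaxations\<close>

fun op_interval :: "elem_op \<Rightarrow> real set list \<Rightarrow> real set" where
  "op_interval (Bin bop a b) Z = {arith_fun bop x y | x y. x \<in> Z ! a \<and> y \<in> Z ! b}"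
| "op_interval (Uni \<beta> a) Z = (\<lambda>x. the (\<beta> x)) ` (Z ! a)"

fun op_interval_defined :: "elem_op \<Rightarrow> real set list \<Rightarrow> bool" where
  "op_interval_defined (Bin bop a b) Z \<longleftrightarrow> (bop = Divide \<longrightarrow> 0 \<notin> Z ! b)"
| "op_interval_defined (Uni \<beta> a) Z \<longleftrightarrow> Z ! a \<subseteq> dom \<beta>"

definition interval_evaluation ::
  "nat \<Rightarrow> nat \<Rightarrow> (nat \<Rightarrow> elem_op) \<Rightarrow> real vec set \<Rightarrow> real set list \<Rightarrow> bool" where
  "interval_evaluation ns nz \<alpha> S Z \<longleftrightarrow> length Z = nz \<and>
     (\<forall>j<ns. Z ! j = (\<lambda>s. s $ j) ` interval_hull S) \<and>
     (\<forall>j\<in>{ns..<nz}. op_interval_defined (\<alpha> j) Z \<and> Z ! j = op_interval (\<alpha> j) Z)"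

text \<open>The operations \<open>z\<^sub>a + z\<^sub>b\<close>, \<open>z\<^sub>a - z\<^sub>b\<close>, \<open>z\<^sub>a + q\<close>, \<open>q z\<^sub>a\<close>, whose defining equality
  \<open>z\<^sub>j = \<alpha>\<^sub>j z\<close> is \<open>r \<bullet> z = c\<close>.  An operation may be both of the form \<open>z\<^sub>a + q\<close> and of the form
  \<open>q z\<^sub>a\<close> (only as \<open>z\<^sub>a + 0 = 1 z\<^sub>a\<close>), but then the equality is the same.\<close>

definition linear_equality :: "nat \<Rightarrow> nat \<Rightarrow> elem_op \<Rightarrow> real vec \<Rightarrow> real \<Rightarrow> bool" where
  "linear_equality n j \<alpha>j r c \<longleftrightarrow>
     (\<exists>a b. \<alpha>j = Bin Plus a b \<and> r = unit_vec n j - unit_vec n a - unit_vec n b \<and> c = 0) \<or>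
     (\<exists>a b. \<alpha>j = Bin Minus a b \<and> r = unit_vec n j - unit_vec n a + unit_vec n b \<and> c = 0) \<or>
     (\<exists>q a. \<alpha>j = Uni (add_const q) a \<and> r = unit_vec n j - unit_vec n a \<and> c = q) \<or>
     (\<exists>q a. \<alpha>j = Uni (mult_const q) a \<and> r = unit_vec n j - q \<cdot>\<^sub>v unit_vec n a \<and> c = 0)"

definition linear_op :: "elem_op \<Rightarrow> bool" where
  "linear_op \<alpha>j \<longleftrightarrow>
     (\<exists>a b. \<alpha>j = Bin Plus a b) \<or> (\<exists>a b. \<alpha>j = Bin Minus a b) \<or>
     (\<exists>q a. \<alpha>j = Uni (add_const q) a) \<or> (\<exists>q a. \<alpha>j = Uni (mult_const q) a)"

definition op_relaxation ::
  "real set list \<Rightarrow> nat \<Rightarrow> elem_op \<Rightarrow> real mat \<Rightarrow> real vec \<Rightarrow> real mat \<Rightarrow> real vec \<Rightarrow> bool" where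
  "op_relaxation Z j \<alpha>j H k A b \<longleftrightarrow>
     (let n = length Z in
      H \<in> carrier_mat (dim_vec k) n \<and> A \<in> carrier_mat (dim_vec b) n \<and>
      {z \<in> box Z. z $ j = op_val \<alpha>j z} \<subseteq> polyhedron n H k A b \<and>
      (linear_op \<alpha>j \<longrightarrow> dim_vec k = 0 \<and>
         (\<exists>r c. linear_equality n j \<alpha>j r c \<and> A = mat_of_rows n [r] \<and> b = vec_of_list [c])))"

section \<open>Stacking, permuting and partitioning constraints\<close>

definition stack_mat :: "nat \<Rightarrow> real mat list \<Rightarrow> real mat" where
  "stack_mat n Ms = mat_of_rows n (concat (map rows Ms))"

definition stack_vec :: "real vec list \<Rightarrow> real vec" where
  "stack_vec vs = vec_of_list (concat (map list_of_vec vs))"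

definition elim_indices :: "nat \<Rightarrow> nat \<Rightarrow> (nat \<Rightarrow> elem_op) \<Rightarrow> nat list" where
  "elim_indices ns nz \<alpha> = filter (\<lambda>j. linear_op (\<alpha> j)) [ns..<nz]"

definition remaining_indices :: "nat \<Rightarrow> nat list \<Rightarrow> nat list" where
  "remaining_indices n Is = filter (\<lambda>j. j \<notin> set Is) [0..<n]"

text \<open>In the stack of \<open>A ns\<close>, \<open>A (ns + 1)\<close>, \<open>\<dots>\<close> the rows of \<open>A j\<close> start at this position.\<close>

definition row_position :: "nat \<Rightarrow> (nat \<Rightarrow> real mat) \<Rightarrow> nat \<Rightarrow> nat" where
  "row_position ns A j = (\<Sum>i\<in>{ns..<j}. dim_row (A i))"

definition select_rows :: "nat list \<Rightarrow> real mat \<Rightarrow> real mat" where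
  "select_rows Is A = mat_of_rows (dim_col A) (map (row A) Is)"

definition select_entries :: "nat list \<Rightarrow> real vec \<Rightarrow> real vec" where
  "select_entries Is b = vec_of_list (map (\<lambda>i. b $ i) Is)"

definition split_cols :: "nat \<Rightarrow> real mat \<Rightarrow> real mat \<times> real mat" where
  "split_cols n A = (mat_of_cols (dim_row A) (take n (cols A)), mat_of_cols (dim_row A) (drop n (cols A)))"

text \<open>Meaningful for invertible matrices only.\<close>

definition mat_inv :: "real mat \<Rightarrow> real mat" where
  "mat_inv A = the (mat_inverse A)"

end

theory Submission
  imports Defs "Jordan_Normal_Form.Determinant"
begin

text \<open>The equalities of the linear operations express each eliminated component through earlier ones,
  so \<open>A\<^sub>e\<^sub>e\<close> is unit lower triangular and \<open>A\<^sub>p z = b\<^sub>p\<close> amounts to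
  \<open>z\<^sub>e = A\<^sub>e\<^sub>e\<^sup>-\<^sup>1 (b\<^sub>e - A\<^sub>e\<^sub>r z\<^sub>r)\<close> together with the remaining equalities.  Substituting this shows that
  \<open>z\<close> is feasible iff \<open>z\<^sub>e\<close> has this value and \<open>z\<^sub>r\<close> lies in the reduced polyhedron, and that then
  \<open>E\<^sub>f z = G\<^sub>f z\<^sub>r + c\<^sub>f\<close>.  The two enclosures therefore differ only in the constraint that \<open>z\<^sub>e\<close> lies in
  \<open>Z\<^sub>e\<close>, which the second claim assumes to be redundant.  The exact set lies in the unreduced one, because
  the vector of factors satisfies all constraints of the relaxation.\<close>

section \<open>Permutations of components\<close>

text \<open>\<open>mat_inv\<close> unwraps the optional result of Gauss-Jordan elimination, so
  success has to be established first: a one-sided inverse of a square matrix is two-sided, hence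
  \<open>A\<close> is a unit and \<open>None\<close> is excluded. Uniqueness of inverses then
  identifies the result.\<close>

lemma mat_inv_eqI:
  assumes A: "A \<in> carrier_mat n n" and B: "B \<in> carrier_mat n n" and AB: "A * B = 1\<^sub>m n"
  shows "mat_inv A = B"
proof -
  have BA: "B * A = 1\<^sub>m n" by (rule mat_mult_left_right_inverse[OF A B AB])
  have "A \<in> Units (ring_mat TYPE(real) n ())"
    unfolding Units_def using A B AB BA by (auto simp: ring_mat_def)
  then obtain C where C: "mat_inverse A = Some C"
    using mat_inverse(1)[OF A, of "()"] by (cases "mat_inverse A") auto
  note C' = mat_inverse(2)[OF A C]
  have "C = C * (A * B)" using C' unfolding AB by (metis right_mult_one_mat)
  also have "\<dots> = (C * A) * B" using assoc_mult_mat[of C n n A n B n] C' A B by simp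
  finally show ?thesis using C C' B by (simp add: mat_inv_def)
qed

text \<open>Serves twice: for the columns, where the eliminated components precede the retained
  ones, and for the rows, where the eliminated equalities come first.\<close>

lemma remaining_indices_permutation:
  assumes "distinct Is" "set Is \<subseteq> {..<n}"
  shows "distinct (Is @ remaining_indices n Is)"
    and "set (Is @ remaining_indices n Is) = {..<n}"
    and "length (Is @ remaining_indices n Is) = n"
proof -
  show d: "distinct (Is @ remaining_indices n Is)"
    using assms by (auto simp: remaining_indices_def)
  show s: "set (Is @ remaining_indices n Is) = {..<n}"
    using assms by (auto simp: remaining_indices_def)
  show "length (Is @ remaining_indices n Is) = n"
    using distinct_card[OF d] s by simp
qed

lemma dim_select_entries[simp]: "dim_vec (select_entries Is z) = length Is"
  unfolding select_entries_def by simp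

lemma select_entries_carrier[simp]: "select_entries Is z \<in> carrier_vec (length Is)"
  by (rule carrier_vecI) simp

lemma index_select_entries[simp]: "i < length Is \<Longrightarrow> select_entries Is z $ i = z $ (Is ! i)"
  unfolding select_entries_def by (simp only: vec_of_list_index) simp

lemma select_entries_append:
  "select_entries (Is @ Js) z = select_entries Is z @\<^sub>v select_entries Js z"
  by (rule eq_vecI) (auto simp: nth_append)

lemma select_entries_eq_iff:
  assumes "v \<in> carrier_vec n" "w \<in> carrier_vec n" "set Is = {..<n}"
  shows "select_entries Is v = select_entries Is w \<longleftrightarrow> v = w"
proof
  assume eq: "select_entries Is v = select_entries Is w"
  show "v = w"
  proof (rule eq_vecI)
    fix i assume "i < dim_vec w"
    then have "i \<in> set Is" using assms by auto
    then obtain k where "k < length Is" "Is ! k = i" by (auto simp: in_set_conv_nth)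
    then show "v $ i = w $ i" using index_select_entries[of k Is] eq by metis
  qed (use assms in auto)
qed simp

lemma select_rows_carrier: "select_rows Is A \<in> carrier_mat (length Is) (dim_col A)"
  unfolding select_rows_def by (rule carrier_matI) simp_all

lemma select_rows_mult_vec:
  assumes "A \<in> carrier_mat m n" "set Is \<subseteq> {..<m}"
  shows "select_rows Is A *\<^sub>v z = select_entries Is (A *\<^sub>v z)"
proof (rule eq_vecI)
  fix i assume "i < dim_vec (select_entries Is (A *\<^sub>v z))"
  then have i: "i < length Is" "Is ! i < m" using assms(2) nth_mem[of i Is] by (simp, force)
  then show "(select_rows Is A *\<^sub>v z) $ i = select_entries Is (A *\<^sub>v z) $ i"
    using assms by (simp add: select_rows_def)
qed (simp add: select_rows_def)

text \<open>The rows of \<open>P\<close> are distinct unit vectors, so \<open>P\<close> times its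
  transpose is the identity and \<open>mat_inv P\<close> is the transpose. Multiplying by it from
  the right only reorders columns, which compensates for reordering the entries of the
  vector.\<close>

lemma
  assumes d: "distinct Is" and s: "set Is = {..<n}" and l: "length Is = n"
    and P: "P = mat_of_rows n (map (unit_vec n) Is)"
  shows mat_inv_permutation_carrier: "mat_inv P \<in> carrier_mat n n"
    and permutation_mult_mat_inv: "P * mat_inv P = 1\<^sub>m n"
    and mult_mat_inv_permutation_index:
      "\<And>M i k. M \<in> carrier_mat m n \<Longrightarrow> i < m \<Longrightarrow> k < n \<Longrightarrow> (M * mat_inv P) $$ (i, k) = M $$ (i, Is ! k)"
    and permutation_mult_vec: "z \<in> carrier_vec n \<Longrightarrow> P *\<^sub>v z = select_entries Is z"
    and mult_mat_inv_permutation_vec: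
      "\<And>M. M \<in> carrier_mat m n \<Longrightarrow> z \<in> carrier_vec n \<Longrightarrow>
        (M * mat_inv P) *\<^sub>v select_entries Is z = M *\<^sub>v z"
proof -
  have Pc: "P \<in> carrier_mat n n" unfolding P using l by (intro carrier_matI) simp_all
  have lt: "Is ! i < n" if "i < n" for i using that s l nth_mem[of i Is] by auto
  have row: "row P i = unit_vec n (Is ! i)" if "i < n" for i
    using that l lt P by simp
  have "P * P\<^sup>T = 1\<^sub>m n"
  proof (rule eq_matI)
    fix i j assume "i < dim_row (1\<^sub>m n)" "j < dim_col (1\<^sub>m n)"
    then have "i < n" "j < n" by auto
    then show "(P * P\<^sup>T) $$ (i, j) = 1\<^sub>m n $$ (i, j)"
      using Pc lt l d by (simp add: row nth_eq_iff_index_eq)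
  qed (use Pc in auto)
  then have inv: "mat_inv P = P\<^sup>T" and PP: "P * mat_inv P = 1\<^sub>m n"
    using mat_inv_eqI[OF Pc, of "P\<^sup>T"] Pc by auto
  show c: "mat_inv P \<in> carrier_mat n n" using inv Pc by simp
  show "P * mat_inv P = 1\<^sub>m n" by (rule PP)
  show "(M * mat_inv P) $$ (i, k) = M $$ (i, Is ! k)"
    if "M \<in> carrier_mat m n" "i < m" "k < n" for M i k
    using that Pc lt by (simp add: inv row)
  show sel: "P *\<^sub>v z = select_entries Is z" if z: "z \<in> carrier_vec n"
  proof (rule eq_vecI)
    fix i assume "i < dim_vec (select_entries Is z)"
    then have i: "i < n" using l by simp
    then show "(P *\<^sub>v z) $ i = select_entries Is z $ i"
      using z Pc lt l by (simp add: row)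
  qed (use Pc l in auto)
  show "(M * mat_inv P) *\<^sub>v select_entries Is z = M *\<^sub>v z"
    if M: "M \<in> carrier_mat m n" and z: "z \<in> carrier_vec n" for M
  proof -
    have "(M * mat_inv P) *\<^sub>v (P *\<^sub>v z) = M *\<^sub>v (mat_inv P *\<^sub>v (P *\<^sub>v z))"
      using assoc_mult_mat_vec[OF M c, of "P *\<^sub>v z"] Pc z by auto
    also have "mat_inv P *\<^sub>v (P *\<^sub>v z) = (mat_inv P * P) *\<^sub>v z"
      using assoc_mult_mat_vec[OF c Pc z] by simp
    also have "mat_inv P * P = 1\<^sub>m n" by (rule mat_mult_left_right_inverse[OF Pc c PP])
    finally show ?thesis using sel[OF z] z by simp
  qed
qed

section \<open>Partitions and stacks\<close>

lemma split_cols: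
  assumes res: "(M1, M2) = split_cols n1 M" and M: "M \<in> carrier_mat m (n1 + n2)"
  shows "M1 \<in> carrier_mat m n1" "M2 \<in> carrier_mat m n2"
    and "a \<in> carrier_vec n1 \<Longrightarrow> b \<in> carrier_vec n2 \<Longrightarrow> M *\<^sub>v (a @\<^sub>v b) = M1 *\<^sub>v a + M2 *\<^sub>v b"
proof -
  have M1: "M1 = mat_of_cols m (take n1 (cols M))" and M2: "M2 = mat_of_cols m (drop n1 (cols M))"
    using res M by (auto simp: split_cols_def)
  show c1: "M1 \<in> carrier_mat m n1" and c2: "M2 \<in> carrier_mat m n2"
    unfolding M1 M2 using M by (auto intro!: carrier_matI)
  show "M *\<^sub>v (a @\<^sub>v b) = M1 *\<^sub>v a + M2 *\<^sub>v b" if a: "a \<in> carrier_vec n1" and b: "b \<in> carrier_vec n2"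
  proof (rule eq_vecI)
    fix i assume "i < dim_vec (M1 *\<^sub>v a + M2 *\<^sub>v b)"
    then have i: "i < m" using c2 by simp
    have "row M i = row M1 i @\<^sub>v row M2 i"
      using i M c1 c2 by (intro eq_vecI) (auto simp: M1 M2 mat_of_cols_index)
    then show "(M *\<^sub>v (a @\<^sub>v b)) $ i = (M1 *\<^sub>v a + M2 *\<^sub>v b) $ i"
      using i M c1 c2 a b by (simp add: scalar_prod_append[of _ n1 _ n2])
  qed (use M c2 in auto)
qed

text \<open>Transfers equations between concatenated vectors to lists, where the laws of append and
  \<open>concat\<close> apply.\<close>

lemma list_of_vec_inject: "list_of_vec v = list_of_vec w \<longleftrightarrow> v = w"
  using vec_list by metis

lemma stack_vec_Cons: "stack_vec (v # vs) = v @\<^sub>v stack_vec vs"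
  unfolding list_of_vec_inject[symmetric] by (simp add: stack_vec_def list_vec)

lemma stack_vec_snoc: "stack_vec (vs @ [v]) = stack_vec vs @\<^sub>v v"
  unfolding list_of_vec_inject[symmetric] by (simp add: stack_vec_def list_vec)

lemma dim_stack_vec: "dim_vec (stack_vec vs) = sum_list (map dim_vec vs)"
  by (simp add: stack_vec_def length_concat o_def)

lemma dim_row_stack_mat: "dim_row (stack_mat n Ms) = sum_list (map dim_row Ms)"
  by (simp add: stack_mat_def length_concat o_def)

text \<open>Equal dimensions of corresponding blocks align the block boundaries; otherwise two
  stacks could agree although their blocks differ.\<close>

lemma stack_vec_map_eq_iff:
  assumes "\<And>j. j \<in> set js \<Longrightarrow> dim_vec (v j) = dim_vec (w j)"
  shows "stack_vec (map v js) = stack_vec (map w js) \<longleftrightarrow> (\<forall>j\<in>set js. v j = w j)"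
  using assms
proof (induction js)
  case (Cons j js)
  then have "v j \<in> carrier_vec (dim_vec (w j))" by (intro carrier_vecI) simp
  then show ?case using Cons by (auto simp: stack_vec_Cons append_vec_eq[of _ "dim_vec (w j)"])
qed simp

lemma stack_vec_map_le_iff:
  assumes "\<And>j. j \<in> set js \<Longrightarrow> dim_vec (v j) = dim_vec (w j)"
  shows "stack_vec (map v js) \<le> stack_vec (map w js) \<longleftrightarrow> (\<forall>j\<in>set js. v j \<le> w j)"
  using assms
proof (induction js)
  case (Cons j js)
  then have "v j \<in> carrier_vec (dim_vec (w j))" by (intro carrier_vecI) simp
  then show ?case using Cons by (auto simp: stack_vec_Cons append_vec_le[of _ "dim_vec (w j)"])
qed simp

lemma concat_rows_carrier:
  assumes "\<And>M. M \<in> set Ms \<Longrightarrow> dim_col M = n"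
  shows "set (concat (map rows Ms)) \<subseteq> carrier_vec n"
proof
  fix r assume "r \<in> set (concat (map rows Ms))"
  then obtain M where "M \<in> set Ms" "r \<in> set (rows M)" by auto
  then show "r \<in> carrier_vec n" using assms rows_carrier by blast
qed

text \<open>Read as lists, both sides are the inner products of \<open>z\<close> with all rows in
  the same order. The common column count ensures that \<open>mat_of_rows\<close> keeps these rows
  unchanged.\<close>

lemma stack_mat_mult_vec:
  assumes "\<And>M. M \<in> set Ms \<Longrightarrow> dim_col M = n"
  shows "stack_mat n Ms *\<^sub>v z = stack_vec (map (\<lambda>M. M *\<^sub>v z) Ms)"
proof -
  let ?R = "concat (map rows Ms)"
  have R: "set ?R \<subseteq> carrier_vec n" by (rule concat_rows_carrier[OF assms])
  have 1: "list_of_vec (M *\<^sub>v z) = map (\<lambda>r. r \<bullet> z) (rows M)" for M :: "real mat"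
    by (rule nth_equalityI) (auto simp: rows_def)
  have "list_of_vec (stack_mat n Ms *\<^sub>v z) = map (\<lambda>r. r \<bullet> z) ?R"
    unfolding 1 stack_mat_def using R by simp
  also have "\<dots> = concat (map (\<lambda>M. list_of_vec (M *\<^sub>v z)) Ms)"
    by (simp add: 1 map_concat o_def)
  also have "\<dots> = list_of_vec (stack_vec (map (\<lambda>M. M *\<^sub>v z) Ms))"
    by (simp add: stack_vec_def list_vec o_def)
  finally show ?thesis by (simp only: list_of_vec_inject)
qed

lemma row_position_Suc: "ns \<le> j \<Longrightarrow> row_position ns A (Suc j) = row_position ns A j + dim_row (A j)"
  unfolding row_position_def by simp

lemma row_position_mono: "i \<le> j \<Longrightarrow> row_position ns A i \<le> row_position ns A j"
  unfolding row_position_def by (rule sum_mono2) auto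

text \<open>Locates a single equality within the stacked system. Splitting the index list at
  \<open>j\<close> leaves \<open>row_position ns A j\<close> rows in front, and the matrices
  \<open>Ms\<close> at the end do not shift them.\<close>

lemma stack_mat_row_position:
  assumes c: "\<And>M. M \<in> set (map A [ns..<nz] @ Ms) \<Longrightarrow> dim_col M = n"
    and j: "j \<in> {ns..<nz}" and i: "i < dim_row (A j)"
  shows "row_position ns A j + i < dim_row (stack_mat n (map A [ns..<nz] @ Ms))"
    and "row (stack_mat n (map A [ns..<nz] @ Ms)) (row_position ns A j + i) = row (A j) i"
proof -
  let ?R = "concat (map rows (map A [ns..<nz] @ Ms))"
  have R: "set ?R \<subseteq> carrier_vec n" by (rule concat_rows_carrier[OF c])
  have "[ns..<nz] = [ns..<j] @ j # [Suc j..<nz]"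
    using j by (metis atLeastLessThan_iff le_Suc_ex upt_add_eq_append upt_conv_Cons less_imp_le_nat)
  then have split: "?R = concat (map (rows \<circ> A) [ns..<j]) @ rows (A j) @
      concat (map (rows \<circ> A) [Suc j..<nz]) @ concat (map rows Ms)" by simp
  have len: "length (concat (map (rows \<circ> A) [ns..<j])) = row_position ns A j"
    by (simp add: row_position_def length_concat o_def interv_sum_list_conv_sum_set_nat)
  show lt: "row_position ns A j + i < dim_row (stack_mat n (map A [ns..<nz] @ Ms))"
    unfolding stack_mat_def split using len i by simp
  have "?R ! (row_position ns A j + i) = row (A j) i"
    unfolding split using len i by (simp add: nth_append)
  then show "row (stack_mat n (map A [ns..<nz] @ Ms)) (row_position ns A j + i) = row (A j) i"
    unfolding stack_mat_def using lt R
    by (metis mat_of_rows_row mat_of_rows_carrier(2) nth_mem stack_mat_def subsetD)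
qed

section \<open>Products of sets of vectors\<close>

lemma vec_times_assoc: "(A \<times>\<^sub>v B) \<times>\<^sub>v C = A \<times>\<^sub>v B \<times>\<^sub>v C"
proof -
  have "(x @\<^sub>v y) @\<^sub>v z = x @\<^sub>v y @\<^sub>v z" for x y z :: "real vec"
    unfolding list_of_vec_inject[symmetric] by simp
  then show ?thesis unfolding vec_times_def by (auto, metis+)
qed

lemma vec_times_carrier:
  "A \<subseteq> carrier_vec m \<Longrightarrow> B \<subseteq> carrier_vec n \<Longrightarrow> A \<times>\<^sub>v B \<subseteq> carrier_vec (m + n)"
  unfolding vec_times_def by auto

lemma constrained_zonotope_carrier: "constrained_zonotope n X \<Longrightarrow> X \<subseteq> carrier_vec n"
  unfolding constrained_zonotope_def by auto

text \<open>Since \<open>S\<close> already projects into the first \<open>m\<close> components of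
  \<open>Z\<close>, restricting the tail to its box amounts to restricting the whole vector. The box
  condition can then be split along any permutation of the components.\<close>

lemma vec_times_box_iff:
  assumes S: "S \<subseteq> carrier_vec m" and proj: "\<And>s j. s \<in> S \<Longrightarrow> j < m \<Longrightarrow> s $ j \<in> Z ! j"
    and m: "m \<le> length Z"
  shows "z \<in> S \<times>\<^sub>v box (drop m Z) \<longleftrightarrow> vec_first z m \<in> S \<and> z \<in> box Z"
proof
  assume "z \<in> S \<times>\<^sub>v box (drop m Z)"
  then obtain s t where z: "z = s @\<^sub>v t" and s: "s \<in> S" and t: "t \<in> box (drop m Z)"
    unfolding vec_times_def by auto
  have ds: "dim_vec s = m" using s S by auto
  have dt: "dim_vec t = length Z - m" and ti: "\<And>i. i < length Z - m \<Longrightarrow> t $ i \<in> Z ! (m + i)"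
    using t m by (auto simp: box_def)
  have "vec_first z m = s" unfolding vec_first_def z using ds by (intro eq_vecI) auto
  moreover have "z $ i \<in> Z ! i" if "i < length Z" for i
    using that ds dt ti[of "i - m"] proj[OF s, of i] m by (auto simp: z)
  moreover have "z \<in> carrier_vec (length Z)" using ds dt m by (intro carrier_vecI) (simp add: z)
  ultimately show "vec_first z m \<in> S \<and> z \<in> box Z" using s by (simp add: box_def)
next
  assume r: "vec_first z m \<in> S \<and> z \<in> box Z"
  then have z: "z \<in> carrier_vec (m + (length Z - m))" using m by (simp add: box_def)
  have "vec_last z (length Z - m) \<in> box (drop m Z)"
    using r z m by (auto simp: box_def vec_last_def)
  then show "z \<in> S \<times>\<^sub>v box (drop m Z)"
    unfolding vec_times_def using r vec_first_last_append[OF z, symmetric] by blast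
qed

section \<open>Interval arithmetic\<close>

lemma interval_hull_superset: "S \<subseteq> interval_hull S"
  unfolding interval_hull_def by auto

lemma op_val_mem_op_interval:
  "(\<And>a. a \<in> op_args \<alpha>j \<Longrightarrow> z $ a \<in> Z ! a) \<Longrightarrow> op_val \<alpha>j z \<in> op_interval \<alpha>j Z"
  by (cases \<alpha>j) auto

text \<open>The inclusion property of interval arithmetic. The induction is strong because operands
  may be arbitrary earlier factors.\<close>

lemma factors_mem_box:
  assumes F: "factors L D ns nz \<alpha> \<zeta>" and I: "interval_evaluation ns nz \<alpha> S Z"
    and hull: "interval_hull S \<subseteq> D" and s: "s \<in> interval_hull S"
  shows "\<zeta> s \<in> box Z"
proof -
  have sD: "s \<in> D" using hull s by auto
  have "\<zeta> s $ j \<in> Z ! j" if "j < nz" for j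
    using that
  proof (induction j rule: less_induct)
    case (less j)
    show ?case
    proof (cases "j < ns")
      case True
      then show ?thesis using F I sD s by (auto simp: factors_def interval_evaluation_def)
    next
      case False
      then have j: "j \<in> {ns..<nz}" using less.prems by simp
      have "\<zeta> s $ a \<in> Z ! a" if "a \<in> op_args (\<alpha> j)" for a
      proof -
        have "a < j" using F j that unfolding factors_def by blast
        then show ?thesis using less by simp
      qed
      then have "op_val (\<alpha> j) (\<zeta> s) \<in> op_interval (\<alpha> j) Z" by (rule op_val_mem_op_interval)
      then show ?thesis using F I sD j by (auto simp: factors_def interval_evaluation_def)
    qed
  qed
  then show ?thesis using F I sD by (auto simp: box_def factors_def interval_evaluation_def)
qed

section \<open>Elimination\<close>

text \<open>The operands have indices below \<open>j\<close>, so their unit vectors contribute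
  nothing from position \<open>j\<close> on. This is the source of the unit lower triangular shape
  of \<open>A_ee\<close>.\<close>

lemma linear_equality_index:
  assumes "linear_equality n j \<alpha>j r c" "op_args \<alpha>j \<subseteq> {..<j}" "j \<le> k" "k < n"
  shows "r $ k = (if k = j then 1 else 0)"
  using assms unfolding linear_equality_def by auto

text \<open>The determinant is the product of the diagonal ones, hence nonzero, so Gauss-Jordan
  elimination succeeds.\<close>

lemma mat_inv_unit_lower_triangular:
  assumes A: "A \<in> carrier_mat n n"
    and tri: "\<And>i j. i < n \<Longrightarrow> j < n \<Longrightarrow> i \<le> j \<Longrightarrow> A $$ (i, j) = (if i = j then 1 else 0)"
  shows "mat_inv A \<in> carrier_mat n n" "A * mat_inv A = 1\<^sub>m n" "mat_inv A * A = 1\<^sub>m n"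
proof -
  have "det A = prod_list (diag_mat A)" by (rule det_lower_triangular[OF _ A]) (simp add: tri)
  also have "diag_mat A = replicate n 1"
    using A tri unfolding diag_mat_def by (intro nth_equalityI) simp_all
  finally have "det A \<noteq> 0" by simp
  then have "A \<in> Units (ring_mat TYPE(real) n ())" by (rule det_non_zero_imp_unit[OF A])
  then obtain C where "mat_inverse A = Some C"
    using mat_inverse(1)[OF A, of "()"] by (cases "mat_inverse A") auto
  then show "mat_inv A \<in> carrier_mat n n" "A * mat_inv A = 1\<^sub>m n" "mat_inv A * A = 1\<^sub>m n"
    using mat_inverse(2)[OF A] by (auto simp: mat_inv_def)
qed

lemma
  fixes v c k :: "real vec"
  assumes "v \<in> carrier_vec n" "c \<in> carrier_vec n" "k \<in> carrier_vec n"
  shows add_le_vec_iff: "v + c \<le> k \<longleftrightarrow> v \<le> k - c"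
    and add_eq_vec_iff: "v + c = k \<longleftrightarrow> v = k - c"
proof -
  show "v + c \<le> k \<longleftrightarrow> v \<le> k - c" using assms by (auto simp: less_eq_vec_def le_diff_eq)
  show "v + c = k \<longleftrightarrow> v = k - c" 
  proof
    assume "v + c = k"
    then show "v = k - c" using assms by (intro eq_vecI) auto
  next
    assume "v = k - c"
    then show "v + c = k" using assms by (intro eq_vecI) auto
  qed
qed

text \<open>Meant for the first block row, with \<open>A_ee\<close> as \<open>A\<close> and
  \<open>A_er\<close> as \<open>C\<close>. Since \<open>B\<close> is a two-sided inverse, solving
  for \<open>x\<close> neither loses nor adds solutions.\<close>

lemma solve_block_row_iff:
  fixes A :: "real mat"
  assumes A: "A \<in> carrier_mat n n" and B: "B \<in> carrier_mat n n" "A * B = 1\<^sub>m n" "B * A = 1\<^sub>m n"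
    and C: "C \<in> carrier_mat n m" and b: "b \<in> carrier_vec n"
    and x: "x \<in> carrier_vec n" and t: "t \<in> carrier_vec m"
  shows "A *\<^sub>v x + C *\<^sub>v t = b \<longleftrightarrow> x = B *\<^sub>v (b - C *\<^sub>v t)"
proof -
  have Ct: "C *\<^sub>v t \<in> carrier_vec n" using C t by simp
  have d: "b - C *\<^sub>v t \<in> carrier_vec n" using b Ct by simp
  have Ax: "A *\<^sub>v x \<in> carrier_vec n" using A x by simp
  have 1: "A *\<^sub>v x + C *\<^sub>v t = b \<longleftrightarrow> A *\<^sub>v x = b - C *\<^sub>v t"
    by (rule add_eq_vec_iff[OF Ax Ct b])
  have "B *\<^sub>v (A *\<^sub>v x) = x" using assoc_mult_mat_vec[OF B(1) A x] B(3) x by simp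
  moreover have "A *\<^sub>v (B *\<^sub>v (b - C *\<^sub>v t)) = b - C *\<^sub>v t"
    using assoc_mult_mat_vec[OF A B(1) d] B(2) d by simp
  ultimately show ?thesis unfolding 1 by metis
qed

text \<open>One computation explains all the reduced data: with \<open>Me\<close> and
  \<open>Mr\<close> taken from \<open>H_p\<close>, from the remaining equalities and from
  \<open>Ef\<close>, the matrix on the right becomes \<open>H_red\<close>, \<open>A_red\<close> and
  \<open>G_f\<close>. The constant vector is moved into \<open>k_red\<close> and
  \<open>b_red\<close>, or is \<open>c_f\<close>.\<close>

lemma substitute_solution:
  fixes Me :: "real mat"
  assumes Me: "Me \<in> carrier_mat k n" and Mr: "Mr \<in> carrier_mat k m"
    and B: "B \<in> carrier_mat n n" and C: "C \<in> carrier_mat n m"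
    and b: "b \<in> carrier_vec n" and t: "t \<in> carrier_vec m"
  shows "Me *\<^sub>v (B *\<^sub>v (b - C *\<^sub>v t)) + Mr *\<^sub>v t = (Mr - Me * B * C) *\<^sub>v t + Me *\<^sub>v (B *\<^sub>v b)"
proof -
  have MB: "Me * B \<in> carrier_mat k n" and MBC: "Me * B * C \<in> carrier_mat k m" using Me B C by auto
  have Ct: "C *\<^sub>v t \<in> carrier_vec n" using C t by simp
  have Bb: "B *\<^sub>v b \<in> carrier_vec n" "B *\<^sub>v (C *\<^sub>v t) \<in> carrier_vec n" using B b Ct by auto
  have "Me *\<^sub>v (B *\<^sub>v (b - C *\<^sub>v t)) = Me *\<^sub>v (B *\<^sub>v b) - Me *\<^sub>v (B *\<^sub>v (C *\<^sub>v t))"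
    using mult_minus_distrib_mat_vec[OF B b Ct] mult_minus_distrib_mat_vec[OF Me Bb] by simp
  moreover have "(Mr - Me * B * C) *\<^sub>v t = Mr *\<^sub>v t - Me *\<^sub>v (B *\<^sub>v (C *\<^sub>v t))"
    using minus_mult_distrib_mat_vec[OF Mr MBC t] assoc_mult_mat_vec[OF MB C t]
      assoc_mult_mat_vec[OF Me B Ct] by simp
  ultimately show ?thesis using Me Mr by (intro eq_vecI) auto
qed

theorem theorem1:
  fixes L :: "(real \<rightharpoonup> real) set"
    and nx nw nu nv ny ns nz ne nr :: nat
    and f g \<zeta> :: "real vec \<Rightarrow> real vec"
    and Df Dg D :: "real vec set"
    and X W V S :: "real vec set"
    and u y :: "real vec"
    and \<alpha> :: "nat \<Rightarrow> elem_op"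
    and Ef El :: "real mat"
    and Z Ze Zr :: "real set list"
    and HQ AQ :: "nat \<Rightarrow> real mat"
    and kQ bQ :: "nat \<Rightarrow> real vec"
  assumes library: "univariate_library L"
    (* system *)
    and f: "factorable L Df (nx + nw + nu) nx f"
    and g: "factorable L Dg (nx + nv) ny g"
    and u: "u \<in> carrier_vec nu"
    and y: "y \<in> carrier_vec ny"
    and X: "constrained_zonotope nx X" "X \<noteq> {}"
    and W: "constrained_zonotope nw W" "W \<noteq> {}"
    and V: "constrained_zonotope nv V" "V \<noteq> {}"
    and ns: "ns = nx + nw + nv"
    and S: "S = X \<times>\<^sub>v W \<times>\<^sub>v V"
    (* factorization of the composite function *)
    and factors: "factors L D ns nz \<alpha> \<zeta>"
    and hull: "interval_hull S \<subseteq> D"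
    and Ef: "selection_mat nx nz Ef"
    and El: "selection_mat ny nz El"
    and composite:
      "\<And>x w v. x \<in> carrier_vec nx \<Longrightarrow> w \<in> carrier_vec nw \<Longrightarrow> v \<in> carrier_vec nv \<Longrightarrow>
         x @\<^sub>v w @\<^sub>v v \<in> D \<Longrightarrow>
         x @\<^sub>v w @\<^sub>v u \<in> Df \<and> f (x @\<^sub>v w @\<^sub>v u) @\<^sub>v v \<in> Dg \<and>
         f (x @\<^sub>v w @\<^sub>v u) = Ef *\<^sub>v \<zeta> (x @\<^sub>v w @\<^sub>v v) \<and>
         g (f (x @\<^sub>v w @\<^sub>v u) @\<^sub>v v) = El *\<^sub>v \<zeta> (x @\<^sub>v w @\<^sub>v v)"
    and order: "composite_order nx nw nv nz \<alpha> Ef El"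
    and X_exact: "X_exact = {f (x @\<^sub>v w @\<^sub>v u) | x w v.
      x \<in> X \<and> w \<in> W \<and> v \<in> V \<and> y = g (f (x @\<^sub>v w @\<^sub>v u) @\<^sub>v v)}"
    (* enclosures *)
    and Z: "interval_evaluation ns nz \<alpha> S Z"
    and Q: "\<And>j. j \<in> {ns..<nz} \<Longrightarrow> op_relaxation Z j (\<alpha> j) (HQ j) (kQ j) (AQ j) (bQ j)"
    and P_ell: "P_ell = {z \<in> carrier_vec nz.
      \<forall>j\<in>{ns..<nz}. z \<in> polyhedron nz (HQ j) (kQ j) (AQ j) (bQ j)}"
    and P_y: "P_y = {z \<in> carrier_vec nz. El *\<^sub>v z = y}"
    and H_p: "H_p = stack_mat nz (map HQ [ns..<nz])"
    and k_p: "k_p = stack_vec (map kQ [ns..<nz])"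
    and A_p: "A_p = stack_mat nz (map AQ [ns..<nz] @ [El])"
    and b_p: "b_p = stack_vec (map bQ [ns..<nz] @ [y])"
    (* elimination *)
    and Ie: "Ie = elim_indices ns nz \<alpha>"
    and Ir: "Ir = remaining_indices nz Ie"
    and ne: "ne = length Ie"
    and nr: "nr = length Ir"
    and U: "U = mat_of_rows nz (map (unit_vec nz) (Ie @ Ir))"
    and Ze: "Ze = map (\<lambda>j. Z ! j) Ie"
    and Zr: "Zr = map (\<lambda>j. Z ! j) Ir"
    and elim_rows: "elim_rows = map (row_position ns AQ) Ie"
    and row_order: "row_order = elim_rows @ remaining_indices (dim_row A_p) elim_rows"
    and A_blocks: "(A_ee, A_er, A_re, A_rr) =
      split_block (select_rows row_order A_p * mat_inv U) ne ne"
    and b_e: "b_e = vec_first (select_entries row_order b_p) ne"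
    and b_r: "b_r = vec_last (select_entries row_order b_p) (dim_vec b_p - ne)"
    and H_blocks: "(H_e, H_r) = split_cols ne (H_p * mat_inv U)"
    and E_blocks: "(E_e, E_r) = split_cols ne (Ef * mat_inv U)"
    (* the two enclosures *)
    and H_red: "H_red = H_r - H_e * mat_inv A_ee * A_er"
    and k_red: "k_red = k_p - H_e *\<^sub>v (mat_inv A_ee *\<^sub>v b_e)"
    and A_red: "A_red = A_rr - A_re * mat_inv A_ee * A_er"
    and b_red: "b_red = b_r - A_re *\<^sub>v (mat_inv A_ee *\<^sub>v b_e)"
    and P_red: "P_red = polyhedron nr H_red k_red A_red b_red"
    and G_f: "G_f = E_r - E_e * mat_inv A_ee * A_er"
    and c_f: "c_f = E_e *\<^sub>v (mat_inv A_ee *\<^sub>v b_e)"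
    and X_red: "X_red = (\<lambda>z. G_f *\<^sub>v z + c_f) ` ((X \<times>\<^sub>v W \<times>\<^sub>v V \<times>\<^sub>v box (drop ns Zr)) \<inter> P_red)"
    and X_full: "X_full = (\<lambda>z. Ef *\<^sub>v z) ` ((X \<times>\<^sub>v W \<times>\<^sub>v V \<times>\<^sub>v box (drop ns Z)) \<inter> P_ell \<inter> P_y)"
  shows "X_exact \<subseteq> X_red \<and>
    ((\<forall>zr \<in> box Zr. mat_inv A_ee *\<^sub>v (b_e - A_er *\<^sub>v zr) \<in> box Ze) \<longrightarrow> X_red = X_full)"
proof -

  \<comment> \<open>Index lists and the permutation of the components\<close>
  define I where "I = [ns..<nz]"
  define m where "m = dim_row A_p"
  define perm where "perm = Ie @ Ir"
  have lenZ: "length Z = nz" and le: "ns \<le> nz"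
    using Z factors by (auto simp: interval_evaluation_def factors_def)

  have Ie_set: "set Ie = {j \<in> {ns..<nz}. linear_op (\<alpha> j)}" and Ie_distinct: "distinct Ie"
    using Ie by (auto simp: elim_indices_def)
  have "sorted Ie" using Ie by (simp add: elim_indices_def sorted_wrt_filter)
  then have Ie_less: "Ie ! i < Ie ! k" if "i < k" "k < ne" for i k
    using that Ie_distinct ne by (metis sorted_wrt_nth_less strict_sorted_iff)
  have Ie_sub: "set Ie \<subseteq> {..<nz}" using Ie_set by auto
  note perm = remaining_indices_permutation[OF Ie_distinct Ie_sub, folded Ir perm_def]
  have nz: "nz = ne + nr" using perm(3) by (simp add: perm_def ne nr)
  have U': "U = mat_of_rows nz (map (unit_vec nz) perm)" by (simp add: U perm_def)
  note perm_mult = mult_mat_inv_permutation_vec[OF perm U']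
  note Uinv = mat_inv_permutation_carrier[OF perm U']
  \<comment> \<open>Eliminated indices are at least \<open>ns\<close>, so the variables
    \<open>s\<close> stay the leading components of the reduced vector, in their original
    order.\<close>
  have Ir_low: "Ir = [0..<ns] @ filter (\<lambda>j. j \<notin> set Ie) [ns..<nz]"
  proof -
    have "[0..<nz] = [0..<ns] @ [ns..<nz]" using le by (metis le_add_diff_inverse upt_add_eq_append zero_le)
    moreover have "filter (\<lambda>j. j \<notin> set Ie) [0..<ns] = [0..<ns]" using Ie_set by (intro filter_True) auto
    ultimately show ?thesis by (simp add: Ir remaining_indices_def)
  qed
  have ns_nr: "ns \<le> nr" using Ir_low nr by simp
  have Ir_nth: "Ir ! i = i" if "i < ns" for i using that by (simp add: Ir_low nth_append)

  \<comment> \<open>Dimensions and the stacked constraints\<close>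
  have HQ: "HQ j \<in> carrier_mat (dim_vec (kQ j)) nz" and AQ: "AQ j \<in> carrier_mat (dim_vec (bQ j)) nz"
    if "j \<in> set I" for j
    using Q[of j] that lenZ by (auto simp: op_relaxation_def Let_def I_def)
  have HQ_dims: "dim_row (HQ j) = dim_vec (kQ j)" "dim_col (HQ j) = nz"
    and AQ_dims: "dim_row (AQ j) = dim_vec (bQ j)" "dim_col (AQ j) = nz" if "j \<in> set I" for j
    using HQ[OF that] AQ[OF that] by auto
  have Elc: "El \<in> carrier_mat ny nz" and Efc: "Ef \<in> carrier_mat nx nz"
    using El Ef by (auto simp: selection_mat_def)
  \<comment> \<open>For a linear operation the relaxation is a single equality, hence exactly one
    row with known coefficients.\<close>
  have linear: "\<exists>r c. linear_equality nz j (\<alpha> j) r c \<and> dim_row (AQ j) = 1 \<and> row (AQ j) 0 = r"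
    if "j \<in> set Ie" for j
  proof -
    have j: "j \<in> {ns..<nz}" "linear_op (\<alpha> j)" using that Ie_set by auto
    then obtain r c where rc: "linear_equality nz j (\<alpha> j) r c" "AQ j = mat_of_rows nz [r]"
      using Q[of j] lenZ by (auto simp: op_relaxation_def Let_def)
    have "r \<in> carrier_vec nz" using rc(1) by (auto simp: linear_equality_def)
    then have "row (AQ j) 0 = r" using rc(2) by simp
    then show ?thesis using rc by auto
  qed

  have A_p_carrier: "A_p \<in> carrier_mat m nz" by (intro carrier_matI) (simp_all add: m_def A_p stack_mat_def)
  have b_p_carrier: "b_p \<in> carrier_vec m"
  proof -
    have "sum_list (map (dim_vec \<circ> bQ) [ns..<nz]) = sum_list (map (dim_row \<circ> AQ) [ns..<nz])"
      using AQ_dims by (intro arg_cong[of _ _ sum_list]) (simp add: I_def)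
    then show ?thesis using y Elc
      by (intro carrier_vecI) (simp add: m_def A_p b_p dim_stack_vec dim_row_stack_mat)
  qed
  define mh where "mh = dim_row H_p"
  have H_p_carrier: "H_p \<in> carrier_mat mh nz" by (intro carrier_matI) (simp_all add: mh_def H_p stack_mat_def)
  have k_p_carrier: "k_p \<in> carrier_vec mh"
  proof -
    have "sum_list (map (dim_vec \<circ> kQ) [ns..<nz]) = sum_list (map (dim_row \<circ> HQ) [ns..<nz])"
      using HQ_dims by (intro arg_cong[of _ _ sum_list]) (simp add: I_def)
    then show ?thesis
      by (intro carrier_vecI) (simp add: mh_def H_p k_p dim_stack_vec dim_row_stack_mat I_def)
  qed

  have A_cols: "dim_col M = nz" if "M \<in> set (map AQ [ns..<nz] @ [El])" for M
    using that AQ_dims Elc by (auto simp: I_def)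
  have feasible: "z \<in> P_ell \<inter> P_y \<longleftrightarrow> H_p *\<^sub>v z \<le> k_p \<and> A_p *\<^sub>v z = b_p"
    if z: "z \<in> carrier_vec nz" for z
  proof -
    have "H_p *\<^sub>v z = stack_vec (map (\<lambda>j. HQ j *\<^sub>v z) I)"
      using HQ_dims by (subst H_p, subst stack_mat_mult_vec) (auto simp: I_def o_def)
    then have H: "H_p *\<^sub>v z \<le> k_p \<longleftrightarrow> (\<forall>j\<in>set I. HQ j *\<^sub>v z \<le> kQ j)"
      unfolding k_p I_def[symmetric] using HQ by (subst stack_vec_map_le_iff[symmetric]) auto
    have A: "A_p *\<^sub>v z = stack_vec (map (\<lambda>j. AQ j *\<^sub>v z) I) @\<^sub>v (El *\<^sub>v z)"
      using A_cols by (subst A_p, subst stack_mat_mult_vec) (auto simp: I_def o_def stack_vec_snoc)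
    have dims: "dim_vec (AQ j *\<^sub>v z) = dim_vec (bQ j)" if "j \<in> set I" for j using AQ[OF that] by auto
    then have "map dim_vec (map (\<lambda>j. AQ j *\<^sub>v z) I) = map dim_vec (map bQ I)" by simp
    then have c: "stack_vec (map (\<lambda>j. AQ j *\<^sub>v z) I) \<in> carrier_vec (dim_vec (stack_vec (map bQ I)))"
      by (intro carrier_vecI) (simp only: dim_stack_vec)
    have "A_p *\<^sub>v z = b_p \<longleftrightarrow>
        stack_vec (map (\<lambda>j. AQ j *\<^sub>v z) I) = stack_vec (map bQ I) \<and> El *\<^sub>v z = y"
      unfolding A b_p I_def[symmetric] map_append list.map stack_vec_snoc
      by (rule append_vec_eq[OF c carrier_vecI[OF refl]])
    also have "\<dots> \<longleftrightarrow> (\<forall>j\<in>set I. AQ j *\<^sub>v z = bQ j) \<and> El *\<^sub>v z = y"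
      using dims by (subst stack_vec_map_eq_iff) auto
    finally show ?thesis using H z by (auto simp: P_ell P_y polyhedron_def I_def)
  qed

  \<comment> \<open>Positions of the eliminated equalities and the row permutation\<close>
  note position = stack_mat_row_position[where A = AQ and ns = ns and nz = nz and Ms = "[El]", OF A_cols, folded A_p]
  have elim_nth: "elim_rows ! i < m" "row A_p (elim_rows ! i) = row (AQ (Ie ! i)) 0" if "i < ne" for i
  proof -
    have "Ie ! i \<in> set Ie" using that ne by simp
    then have j: "Ie ! i \<in> {ns..<nz}" "0 < dim_row (AQ (Ie ! i))" using Ie_set linear[of "Ie ! i"] by auto
    show "elim_rows ! i < m" "row A_p (elim_rows ! i) = row (AQ (Ie ! i)) 0"
      using position[OF _ j] that by (auto simp: elim_rows ne m_def)
  qed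
  \<comment> \<open>Each eliminated operation occupies one full row, so the next eliminated one
    starts at least one row later. This gives distinctness of \<open>elim_rows\<close>.\<close>
  have elim_less: "elim_rows ! i < elim_rows ! k" if "i < k" "k < ne" for i k
  proof -
    have "Ie ! i \<in> set Ie" using that ne by simp
    then have "ns \<le> Ie ! i" "dim_row (AQ (Ie ! i)) = 1" using Ie_set linear by auto
    then have "row_position ns AQ (Suc (Ie ! i)) = row_position ns AQ (Ie ! i) + 1"
      by (simp add: row_position_Suc)
    then show ?thesis
      using row_position_mono[of "Suc (Ie ! i)" "Ie ! k" ns AQ] Ie_less[OF that] that
      by (simp add: elim_rows ne)
  qed
  have elim_len: "length elim_rows = ne" by (simp add: elim_rows ne)
  have "distinct elim_rows"
    unfolding distinct_conv_nth elim_len using elim_less by (metis nat_neq_iff)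
  moreover have "set elim_rows \<subseteq> {..<m}" using elim_nth(1) elim_len by (auto simp: in_set_conv_nth)
  ultimately have order: "distinct row_order" "set row_order = {..<m}" "length row_order = m"
    using remaining_indices_permutation[of elim_rows m] by (auto simp: row_order m_def)
  have ne_m: "ne \<le> m" using order(3) elim_len by (simp add: row_order)

  \<comment> \<open>Block form of the equality system\<close>
  define M where "M = select_rows row_order A_p"
  define b where "b = select_entries row_order b_p"
  have Mc: "M \<in> carrier_mat m nz"
    using select_rows_carrier[of row_order A_p] A_p_carrier order(3) by (simp add: M_def)
  have MU: "M * mat_inv U \<in> carrier_mat m nz" using Mc Uinv by simp
  have bc: "b \<in> carrier_vec (ne + (m - ne))" using ne_m order(3) by (intro carrier_vecI) (simp add: b_def)
  have b_split: "b = b_e @\<^sub>v b_r"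
    using vec_first_last_append[OF bc] b_p_carrier by (simp add: b_e b_r b_def)
  have b_e_carrier: "b_e \<in> carrier_vec ne" and b_r_carrier: "b_r \<in> carrier_vec (m - ne)"
    using b_p_carrier by (simp_all add: b_e b_r)
  note res = A_blocks[symmetric, folded M_def]
  have blocks: "A_ee \<in> carrier_mat ne ne" "A_er \<in> carrier_mat ne nr"
    "A_re \<in> carrier_mat (m - ne) ne" "A_rr \<in> carrier_mat (m - ne) nr"
    "M * mat_inv U = four_block_mat A_ee A_er A_re A_rr"
    using split_block[OF res, of "m - ne" nr] carrier_matD[OF MU] ne_m nz by simp_all
  \<comment> \<open>With both permutations undone, this entry is the coefficient of component
    \<open>Ie ! k\<close> in the equality of operation \<open>Ie ! i\<close>. As \<open>Ie\<close>
    ascends, \<open>i \<le> k\<close> puts that component at or beyond the index of the operation,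
    where \<open>linear_equality_index\<close> applies.\<close>
  have tri: "A_ee $$ (i, k) = (if i = k then 1 else 0)" if ik: "i < ne" "k < ne" "i \<le> k" for i k
  proof -
    have "A_ee $$ (i, k) = (M * mat_inv U) $$ (i, k)" using ik res by (simp add: split_block_def Let_def del: index_mult_mat) fastforce
    also have "\<dots> = M $$ (i, perm ! k)"
      using mult_mat_inv_permutation_index[OF perm U' Mc] ik ne_m nz by auto
    also have "perm ! k = Ie ! k" using ik ne by (simp add: perm_def nth_append)
    also have "M $$ (i, Ie ! k) = row (AQ (Ie ! i)) 0 $ (Ie ! k)"
    proof -
      have "Ie ! k < nz" using ik ne Ie_sub nth_mem[of k Ie] by blast
      moreover have "row_order ! i = elim_rows ! i" using ik elim_len by (simp add: row_order nth_append)
      ultimately show ?thesis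
        using ik ne_m order(3) elim_nth[of i] A_p_carrier
        by (simp add: M_def select_rows_def mat_of_rows_index)
    qed
    also have "\<dots> = (if Ie ! k = Ie ! i then 1 else 0)"
    proof -
      have i: "Ie ! i \<in> set Ie" using ik ne by simp
      then obtain r c where rc: "linear_equality nz (Ie ! i) (\<alpha> (Ie ! i)) r c" "row (AQ (Ie ! i)) 0 = r"
        using linear by blast
      have args: "op_args (\<alpha> (Ie ! i)) \<subseteq> {..<Ie ! i}"
        using factors i Ie_set by (auto simp: factors_def)
      have "Ie ! i \<le> Ie ! k" using ik Ie_less[of i k] by (cases "i = k") auto
      moreover have "Ie ! k < nz" using ik ne Ie_sub nth_mem[of k Ie] by blast
      ultimately show ?thesis using linear_equality_index[OF rc(1) args] rc(2) by simp
    qed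
    also have "\<dots> = (if i = k then 1 else 0)"
      using ik ne Ie_distinct by (auto simp: nth_eq_iff_index_eq)
    finally show ?thesis .
  qed
  have inv: "mat_inv A_ee \<in> carrier_mat ne ne" "A_ee * mat_inv A_ee = 1\<^sub>m ne" "mat_inv A_ee * A_ee = 1\<^sub>m ne"
    by (rule mat_inv_unit_lower_triangular[OF blocks(1)], rule tri, assumption+)+
  \<comment> \<open>The value that the eliminated equalities force on the eliminated components when
    the retained ones are \<open>t\<close>.\<close>
  define \<phi> where "\<phi> = (\<lambda>t. mat_inv A_ee *\<^sub>v (b_e - A_er *\<^sub>v t))"
  have \<phi>_carrier: "\<phi> t \<in> carrier_vec ne" if "t \<in> carrier_vec nr" for t
    using that inv(1) blocks(2) b_e_carrier by (auto simp: \<phi>_def intro!: mult_mat_vec_carrier minus_carrier_vec)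

  \<comment> \<open>Equivalence of the full and the reduced constraints\<close>
  have sel: "select_entries perm z = select_entries Ie z @\<^sub>v select_entries Ir z" for z
    by (simp add: perm_def select_entries_append)
  have zec: "select_entries Ie z \<in> carrier_vec ne" and zrc: "select_entries Ir z \<in> carrier_vec nr" for z
    by (simp_all add: ne nr)
  have HU: "H_p * mat_inv U \<in> carrier_mat mh (ne + nr)" and EU: "Ef * mat_inv U \<in> carrier_mat nx (ne + nr)"
    using H_p_carrier Efc Uinv nz by auto
  note H = split_cols[OF H_blocks HU] and E = split_cols[OF E_blocks EU]

  have solved_b: "mat_inv A_ee *\<^sub>v b_e \<in> carrier_vec ne"
    by (rule mult_mat_vec_carrier[OF inv(1) b_e_carrier])

  have A_iff: "A_p *\<^sub>v z = b_p \<longleftrightarrow>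
      select_entries Ie z = \<phi> (select_entries Ir z) \<and>
      A_re *\<^sub>v select_entries Ie z + A_rr *\<^sub>v select_entries Ir z = b_r"
    if z: "z \<in> carrier_vec nz" for z
  proof -
    have "A_p *\<^sub>v z = b_p \<longleftrightarrow> M *\<^sub>v z = b"
      using select_rows_mult_vec[OF A_p_carrier, of row_order] order(2) A_p_carrier z b_p_carrier
      by (simp add: M_def b_def select_entries_eq_iff[of _ m])
    also have "M *\<^sub>v z = (A_ee *\<^sub>v select_entries Ie z + A_er *\<^sub>v select_entries Ir z) @\<^sub>v
        (A_re *\<^sub>v select_entries Ie z + A_rr *\<^sub>v select_entries Ir z)"
      \<comment> \<open>Used backwards: \<open>M\<close> applied to \<open>z\<close> becomes
        \<open>M * mat_inv U\<close> applied to the reordered vector, which exposes the four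
        blocks.\<close>
      unfolding perm_mult[OF Mc z, symmetric] sel blocks(5)
      by (rule four_block_mat_mult_vec[OF blocks(1-4) zec zrc])
    also have "\<dots> = b \<longleftrightarrow> A_ee *\<^sub>v select_entries Ie z + A_er *\<^sub>v select_entries Ir z = b_e \<and>
        A_re *\<^sub>v select_entries Ie z + A_rr *\<^sub>v select_entries Ir z = b_r"
      unfolding b_split using blocks zec zrc b_e_carrier by (intro append_vec_eq[of _ ne]) auto
    finally show ?thesis
      unfolding \<phi>_def using solve_block_row_iff[OF blocks(1) inv blocks(2) b_e_carrier zec zrc] by simp
  qed

  have H_red_carrier: "H_red \<in> carrier_mat mh nr" and A_red_carrier: "A_red \<in> carrier_mat (m - ne) nr"
    unfolding H_red A_red by (rule minus_carrier_mat mult_carrier_mat H blocks inv(1))+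
  \<comment> \<open>The first block row fixes the eliminated components. Under that equation,
    substitution turns the inequalities and the remaining equalities into those of
    \<open>P_red\<close>, so both equivalences below are only claimed conditionally on it.\<close>
  have reduced: "z \<in> P_ell \<inter> P_y \<longleftrightarrow>
      select_entries Ie z = \<phi> (select_entries Ir z) \<and> select_entries Ir z \<in> P_red"
    if z: "z \<in> carrier_vec nz" for z
  proof -
    let ?t = "select_entries Ir z"
    have "H_p *\<^sub>v z \<le> k_p \<longleftrightarrow> H_red *\<^sub>v ?t \<le> k_red" if eq: "select_entries Ie z = \<phi> ?t"
    proof -
      have "H_p *\<^sub>v z = H_red *\<^sub>v ?t + H_e *\<^sub>v (mat_inv A_ee *\<^sub>v b_e)"
        using perm_mult[OF H_p_carrier z] H(3)[OF zec zrc, of z z] eq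
          substitute_solution[OF H(1,2) inv(1) blocks(2) b_e_carrier zrc, of z]
        unfolding sel \<phi>_def H_red by (simp only:)
      then show ?thesis
        unfolding k_red
        using add_le_vec_iff[OF mult_mat_vec_carrier[OF H_red_carrier zrc]
            mult_mat_vec_carrier[OF H(1) solved_b] k_p_carrier] by (simp only:)
    qed
    moreover have "A_re *\<^sub>v select_entries Ie z + A_rr *\<^sub>v ?t = b_r \<longleftrightarrow> A_red *\<^sub>v ?t = b_red"
      if eq: "select_entries Ie z = \<phi> ?t"
    proof -
      have "A_re *\<^sub>v select_entries Ie z + A_rr *\<^sub>v ?t = A_red *\<^sub>v ?t + A_re *\<^sub>v (mat_inv A_ee *\<^sub>v b_e)"
        using eq substitute_solution[OF blocks(3,4) inv(1) blocks(2) b_e_carrier zrc, of z]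
        unfolding \<phi>_def A_red by (simp only:)
      then show ?thesis
        unfolding b_red
        using add_eq_vec_iff[OF mult_mat_vec_carrier[OF A_red_carrier zrc]
            mult_mat_vec_carrier[OF blocks(3) solved_b] b_r_carrier] by (simp only:)
    qed
    ultimately show ?thesis
      unfolding feasible[OF z] A_iff[OF z] P_red polyhedron_def using zrc by auto
  qed
  have image: "Ef *\<^sub>v z = G_f *\<^sub>v select_entries Ir z + c_f"
    if z: "z \<in> carrier_vec nz" and eq: "select_entries Ie z = \<phi> (select_entries Ir z)" for z
    using perm_mult[OF Efc z] E(3)[OF zec zrc, of z z] eq
      substitute_solution[OF E(1,2) inv(1) blocks(2) b_e_carrier zrc, of z]
    unfolding sel \<phi>_def G_f c_f by (simp only:)

  \<comment> \<open>Products of sets and boxes\<close>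
  have S_carrier: "S \<subseteq> carrier_vec ns"
    unfolding S ns using X(1) W(1) V(1)
    by (metis vec_times_carrier constrained_zonotope_carrier add.assoc)
  have S_proj: "s $ j \<in> Z ! j" if "s \<in> S" "j < ns" for s j
    using Z that interval_hull_superset[of S] by (auto simp: interval_evaluation_def)
  have full_iff: "z \<in> X \<times>\<^sub>v W \<times>\<^sub>v V \<times>\<^sub>v box (drop ns Z) \<longleftrightarrow> vec_first z ns \<in> S \<and> z \<in> box Z" for z
    using vec_times_box_iff[OF S_carrier S_proj] le lenZ by (simp add: S vec_times_assoc)
  \<comment> \<open>As \<open>Ir ! i = i\<close> for \<open>i < ns\<close>, the leading components
    of \<open>Zr\<close> are those of \<open>Z\<close>, so \<open>S\<close> projects into them as
    well.\<close>
  have red_iff: "t \<in> X \<times>\<^sub>v W \<times>\<^sub>v V \<times>\<^sub>v box (drop ns Zr) \<longleftrightarrow> vec_first t ns \<in> S \<and> t \<in> box Zr" for t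
    using vec_times_box_iff[OF S_carrier, of Zr t] S_proj ns_nr
    by (simp add: S vec_times_assoc Zr Ir_nth nr)
  have first_eq: "vec_first (select_entries Ir z) ns = vec_first z ns" for z
    using ns_nr nr by (intro eq_vecI) (auto simp: vec_first_def Ir_nth)
  have box_iff: "z \<in> box Z \<longleftrightarrow> select_entries Ie z \<in> box Ze \<and> select_entries Ir z \<in> box Zr"
    if z: "z \<in> carrier_vec nz" for z
  proof -
    have "z \<in> box Z \<longleftrightarrow> (\<forall>j\<in>set perm. z $ j \<in> Z ! j)" using z lenZ perm(2) by (auto simp: box_def)
    also have "\<dots> \<longleftrightarrow> (\<forall>i<length Ie. z $ (Ie ! i) \<in> Z ! (Ie ! i)) \<and> (\<forall>i<length Ir. z $ (Ir ! i) \<in> Z ! (Ir ! i))"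
      unfolding perm_def set_append ball_Un by (simp add: all_set_conv_all_nth)
    finally show ?thesis by (simp add: box_def Ze Zr)
  qed

  \<comment> \<open>Inclusions between the three sets\<close>
  have full_red: "X_full \<subseteq> X_red"
  proof
    fix p assume "p \<in> X_full"
    then obtain z where p: "p = Ef *\<^sub>v z" and zS: "z \<in> X \<times>\<^sub>v W \<times>\<^sub>v V \<times>\<^sub>v box (drop ns Z)" and zP: "z \<in> P_ell \<inter> P_y"
      unfolding X_full by blast
    then have z: "z \<in> carrier_vec nz" using P_y by simp
    note eq = zP[unfolded reduced[OF z]]
    \<comment> \<open>Passing to the retained components discards exactly the condition that the
      eliminated ones lie in \<open>box Ze\<close>. The inclusion is therefore unconditional and
      contributes to both claims.\<close>
    have "select_entries Ir z \<in> (X \<times>\<^sub>v W \<times>\<^sub>v V \<times>\<^sub>v box (drop ns Zr)) \<inter> P_red"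
      using eq zS[unfolded full_iff] box_iff[OF z] by (simp add: red_iff first_eq)
    then show "p \<in> X_red" unfolding X_red p using image[OF z] eq by blast
  qed
  \<comment> \<open>The first claim goes through the unreduced enclosure. The witness is
    \<open>\<zeta> s\<close>: it lies in \<open>box Z\<close> and each factor equals the value of
    its operation, so every relaxation contains it.\<close>
  have "X_exact \<subseteq> X_full"
  proof
    fix p assume "p \<in> X_exact"
    then obtain x w v where xwv: "x \<in> X" "w \<in> W" "v \<in> V"
      and p: "p = f (x @\<^sub>v w @\<^sub>v u)" and yg: "y = g (f (x @\<^sub>v w @\<^sub>v u) @\<^sub>v v)"
      unfolding X_exact by auto
    define s where "s = x @\<^sub>v w @\<^sub>v v"
    have sS: "s \<in> S" unfolding s_def S vec_times_def using xwv by blast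
    then have sh: "s \<in> interval_hull S" using interval_hull_superset by blast
    then have sD: "s \<in> D" using hull by blast
    have \<zeta>c: "\<zeta> s \<in> carrier_vec nz" and low: "\<And>j. j < ns \<Longrightarrow> \<zeta> s $ j = s $ j"
      and ops: "\<And>j. j \<in> {ns..<nz} \<Longrightarrow> \<zeta> s $ j = op_val (\<alpha> j) (\<zeta> s)"
      using factors sD by (auto simp: factors_def)
    have box: "\<zeta> s \<in> box Z" by (rule factors_mem_box[OF factors Z hull sh])
    have "x \<in> carrier_vec nx" "w \<in> carrier_vec nw" "v \<in> carrier_vec nv"
      using xwv X(1) W(1) V(1) constrained_zonotope_carrier by blast+
    note comp = composite[OF this sD[unfolded s_def]]
    have "vec_first (\<zeta> s) ns = s"
      using sS S_carrier low by (intro eq_vecI) (auto simp: vec_first_def)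
    then have "\<zeta> s \<in> X \<times>\<^sub>v W \<times>\<^sub>v V \<times>\<^sub>v box (drop ns Z)" using box sS by (simp add: full_iff)
    moreover have "\<zeta> s \<in> polyhedron nz (HQ j) (kQ j) (AQ j) (bQ j)" if "j \<in> {ns..<nz}" for j
      using Q[OF that] box ops[OF that] lenZ by (auto simp: op_relaxation_def Let_def)
    then have "\<zeta> s \<in> P_ell" using \<zeta>c by (simp add: P_ell)
    moreover have "\<zeta> s \<in> P_y" unfolding P_y s_def using \<zeta>c[unfolded s_def] comp yg by auto
    moreover have "p = Ef *\<^sub>v \<zeta> s" using comp p by (simp add: s_def)
    ultimately show "p \<in> X_full" unfolding X_full by blast
  qed
  moreover have "X_red \<subseteq> X_full" if incl: "\<forall>t \<in> box Zr. \<phi> t \<in> box Ze"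
  proof
    fix p assume "p \<in> X_red"
    then obtain t where p: "p = G_f *\<^sub>v t + c_f" and tS: "t \<in> X \<times>\<^sub>v W \<times>\<^sub>v V \<times>\<^sub>v box (drop ns Zr)"
      and tP: "t \<in> P_red"
      unfolding X_red by blast
    have t: "t \<in> carrier_vec nr" using tP by (simp add: P_red polyhedron_def)
    \<comment> \<open>The witness has \<open>\<phi> t\<close> in the eliminated positions and
      \<open>t\<close> in the retained ones; \<open>mat_inv U\<close> restores the original
      order.\<close>
    define z where "z = mat_inv U *\<^sub>v (\<phi> t @\<^sub>v t)"
    have c: "\<phi> t @\<^sub>v t \<in> carrier_vec nz" using \<phi>_carrier[OF t] t nz by simp
    have z: "z \<in> carrier_vec nz" unfolding z_def using Uinv c by simp
    have Uc: "U \<in> carrier_mat nz nz" unfolding U' using perm(3) by (intro carrier_matI) simp_all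
    have "U *\<^sub>v z = \<phi> t @\<^sub>v t"
      using assoc_mult_mat_vec[OF Uc Uinv c] permutation_mult_mat_inv[OF perm U'] c by (simp add: z_def)
    then have "select_entries Ie z @\<^sub>v select_entries Ir z = \<phi> t @\<^sub>v t"
      using permutation_mult_vec[OF perm U' z] sel by simp
    then have parts: "select_entries Ie z = \<phi> t" "select_entries Ir z = t"
      using append_vec_eq[OF zec \<phi>_carrier[OF t]] by auto
    have "z \<in> P_ell \<inter> P_y" using reduced[OF z] parts tP by simp
    \<comment> \<open>\<open>incl\<close> supplies the box condition on the eliminated components,
      the only one not inherited from \<open>t\<close>.\<close>
    moreover have "z \<in> X \<times>\<^sub>v W \<times>\<^sub>v V \<times>\<^sub>v box (drop ns Z)"
      using full_iff box_iff[OF z] parts tS[unfolded red_iff] incl first_eq[of z] by simp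
    moreover have "p = Ef *\<^sub>v z" using image[OF z] parts p by simp
    ultimately show "p \<in> X_full" unfolding X_full by blast
  qed
  ultimately show ?thesis using full_red unfolding \<phi>_def by blast
qed

end
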